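(* For every $\bar\lambda=(\lambda_0,\lambda_1,\lambda_2)$ with all $\lambda_i>0$ and $\lambda_0+\lambda_1+\lambda_2=1$ there exist $\bar a=(a_0,a_1,a_2)$ and $\bar c=(c_0,c_1,c_2)$ with all entries $>0$ such that, for every $\bar\omega=(\omega_0,\omega_1,\omega_2)$ with $\omega_i\ge0$ and $\sum_i\omega_i=1$: (1) $\Psi(\bar\omega,\bar\lambda,\bar a,\bar c)\le 3^{1-\gamma}$; (2) for any $\varepsilon>0$, if $(\lambda_1,\lambda_2)\notin\mathcal U_\varepsilon(1/3,1/3)$, then $\Psi(\bar\omega,\bar\lambda,\bar a,\bar c)\le 3^{1-\gamma}-\delta$ for some $\delta>0$.
   Context: Fix an integer $k\ge 3$ and a real $\gamma<1$ with $k\gamma>2$. Let $q(x)=e^x-x-1$ and $Q(x)=xq'(x)/q(x)=x(e^x-1)/(e^x-x-1)$ for $x>0$; $s>0$ is defined by $Q(s)=k\gamma$. Let $r(x_0,x_1,x_2)=\sum\binom{k}{k_0,k_1,k_2}x_0^{k_0}x_1^{k_1}x_2^{k_2}$, summed over nonnegative integers $k_0+k_1+k_2=k$ with $k_1\equiv k_2\pmod 3$. For $x_i,y_i>0$ define $\Psi(\bar\omega,\bar\lambda,\bar x,\bar y)=\prod_{i=0}^2\left(\frac{q(x_i)}{\omega_i q(s)}\right)^{\omega_i}\cdot\left[\prod_{i=0}^2\left(\frac{\lambda_i s}{x_iy_i}\right)^{\lambda_i}\right]^{k\gamma} r(y_0,y_1,y_2)^{\gamma}$, with the convention $\alpha^\alpha=1$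 for $\alpha=0$. For reals $a,b$, $\mathcal U_\varepsilon(a,b)=\{(c,d):|c-a|<\varepsilon,|d-b|<\varepsilon\}$. *)

theory Defs
  imports "HOL-Analysis.Analysis"
begin

definition q :: "real \<Rightarrow> real" where
  "q x = exp x - x - 1"

definition Q :: "real \<Rightarrow> real" where
  "Q x = x * deriv q x / q x"

text \<open>Triples \<open>(x\<^sub>0, x\<^sub>1, x\<^sub>2)\<close> of reals are functions on the natural numbers of which only
  the values at 0, 1, 2 are ever used.\<close>

definition r :: "nat \<Rightarrow> (nat \<Rightarrow> real) \<Rightarrow> real" where
  "r k x = (\<Sum>(k0, k1, k2) \<in> {(k0, k1, k2). k0 + k1 + k2 = k \<and> k1 mod 3 = k2 mod 3}.
     fact k / (fact k0 * fact k1 * fact k2) * x 0 ^ k0 * x 1 ^ k1 * x 2 ^ k2)"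

text \<open>Real powers in which the exponent 0 always gives 1. This is the convention
  \<open>\<alpha>\<^sup>\<alpha> = 1\<close> for \<open>\<alpha> = 0\<close>: the factor \<open>(u / \<alpha>)\<^sup>\<alpha>\<close> is read as \<open>u\<^sup>\<alpha> / \<alpha>\<^sup>\<alpha>\<close>, hence is 1 for
  \<open>\<alpha> = 0\<close>. Plain \<open>powr\<close> would give 0 there, since \<open>u / 0 = 0\<close> and \<open>0 powr 0 = 0\<close>.\<close>

definition cpow :: "real \<Rightarrow> real \<Rightarrow> real" where
  "cpow b e = (if e = 0 then 1 else b powr e)"

definition Psi :: "nat \<Rightarrow> real \<Rightarrow> real \<Rightarrow>
    (nat \<Rightarrow> real) \<Rightarrow> (nat \<Rightarrow> real) \<Rightarrow> (nat \<Rightarrow> real) \<Rightarrow> (nat \<Rightarrow> real) \<Rightarrow> real" where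
  "Psi k \<gamma> s \<omega> l x y =
     (\<Prod>i\<le>2. cpow (q (x i) / (\<omega> i * q s)) (\<omega> i))
     * (\<Prod>i\<le>2. cpow (l i * s / (x i * y i)) (l i)) powr (real k * \<gamma>)
     * r k y powr \<gamma>"

definition U :: "real \<Rightarrow> real \<Rightarrow> real \<Rightarrow> (real \<times> real) set" where
  "U \<epsilon> a b = {(c, d). \<bar>c - a\<bar> < \<epsilon> \<and> \<bar>d - b\<bar> < \<epsilon>}"

end

theory Submission
  imports Defs
begin

text \<open>
  Put \<open>K = k\<gamma>\<close> and \<open>n = K - 1\<close>. Discrete Fourier transform on \<open>\<int>/3\<close> gives \<open>r(c) \<le> (1 + 2x\<^sup>k)/3\<close> when
  \<open>\<Sum> c\<^sub>i = 1\<close>, where \<open>x\<close> is the modulus of the nontrivial Fourier coefficient of \<open>c\<close>. Replace \<open>r\<close> by this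
  bound and choose \<open>c\<close> stationary for it, \<open>\<lambda>\<^sub>i (1 + 2x\<^sup>k) = c\<^sub>i w\<^sub>i\<close> with \<open>w\<^sub>i = 1 + x\<^sup>k\<^sup>-\<^sup>2(3c\<^sub>i - 1)\<close>;
  such a \<open>c\<close> exists by Brouwer's theorem. Taking \<open>a\<close> proportional to \<open>w\<close>, the product over \<open>\<lambda>\<close> collapses to
  a constant. With \<open>\<rho> = x\<^sup>k\<^sup>-\<^sup>1\<close>, the vector \<open>w\<close> has the same first two power sums as
  \<open>(1 + 2\<rho>, 1 - \<rho>, 1 - \<rho>)\<close>, which maximises \<open>\<Sum> q(a\<^sub>i)\<close>; scaling so that the largest entry is \<open>s\<close> and
  using convexity of \<open>u\<^sup>2/q(u)\<close> eliminates \<open>s\<close>. What remains is a one-variable inequality,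
  \<open>(1 + 2\<rho>)\<^sup>n (1 + (n-1)\<rho> + 2n\<rho>\<^sup>2) \<le> (1 + (3n-1)\<rho>) (1 + 2\<rho>\<^sup>1\<^sup>+\<^sup>1\<^sup>/\<^sup>n)\<^sup>n\<close> for \<open>\<rho> \<in> [0, 1]\<close>. Finally, since
  \<open>\<gamma> < 1\<close>, the monotonicity of \<open>\<ell>\<^sup>p\<close> norms yields a factor below 1 unless \<open>x = 0\<close>, and \<open>x\<close> controls the
  distance of \<open>\<lambda>\<close> from the centre \<open>(1/3, 1/3, 1/3)\<close>.
\<close>

section \<open>A power mean inequality\<close>

text \<open>The left side is the derivative of the logarithmic quotient \<open>D\<close> of the next
  lemma, with \<open>x\<close> standing for \<open>\<rho> powr (1/n)\<close>. Over a common
  denominator the numerator is linear in \<open>x\<close>, so its sign comes from comparing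
  \<open>x * N\<close> with \<open>n * \<rho> * P\<close>.\<close>

lemma power_mean_deriv_sign:
  fixes m \<rho> x :: real
  assumes "m > 0" "\<rho> > 0" "x > 0"
  defines "n \<equiv> 1 + m"
  defines "P \<equiv> (2 + 4*m) + (8 + 7*m + 3*m^2) * \<rho> + (8 + 16*m + 6*m^2) * \<rho>^2"
  defines "N \<equiv> (2 + m) + (8 + 12*m + 4*m^2) * \<rho> + (8 + 18*m + 10*m^2 + 3*m^3) * \<rho>^2
                 + (14*m + 22*m^2 + 6*m^3) * \<rho>^3"
  shows "2 * (n + 1) * x / (1 + 2*\<rho>*x) - 2 * n / (1 + 2*\<rho>) + (3*n - 1) / (1 + (3*n - 1)*\<rho>)
          - (n - 1 + 4*n*\<rho>) / (1 + (n - 1)*\<rho> + 2*n*\<rho>^2)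
       = 2 * (x * N - n * \<rho> * P)
          / ((1 + 2*\<rho>*x) * ((1 + 2*\<rho>) * (1 + (3*n - 1)*\<rho>) * (1 + (n - 1)*\<rho> + 2*n*\<rho>^2)))"
proof -
  define A B C where "A = 1 + 2*\<rho>" and "B = 1 + (3*n - 1)*\<rho>" and "C = 1 + (n - 1)*\<rho> + 2*n*\<rho>^2"
  define M where "M = 1 + 2*\<rho>*x"
  have pos: "A > 0" "B > 0" "C > 0" "M > 0"
    using assms unfolding A_def B_def C_def M_def n_def
    by (auto intro!: add_pos_nonneg mult_nonneg_nonneg add_pos_pos)
  \<comment> \<open>The first identity combines the three fractions free of \<open>x\<close>; the
    second collects the coefficient of \<open>x\<close> once \<open>M\<close> is expanded.\<close>
  have 1: "2*n*(B*C) - (3*n - 1)*(A*C) + (n - 1 + 4*n*\<rho>)*(A*B) = 2*n*\<rho>*P"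
    unfolding A_def B_def C_def P_def n_def by algebra
  have 2: "(n + 1)*(A*B*C) - 2*n*\<rho>^2*P = N"
    unfolding A_def B_def C_def P_def N_def n_def by algebra
  have "2 * (n + 1) * x / M - 2 * n / A + (3*n - 1) / B - (n - 1 + 4*n*\<rho>) / C
     = (2*(n+1)*x*(A*B*C) - M * (2*n*(B*C) - (3*n - 1)*(A*C) + (n - 1 + 4*n*\<rho>)*(A*B))) / (M*(A*B*C))"
    using pos by (simp add: divide_simps) (simp add: algebra_simps)
  also have "2*(n+1)*x*(A*B*C) - M * (2*n*(B*C) - (3*n - 1)*(A*C) + (n - 1 + 4*n*\<rho>)*(A*B))
     = 2 * (x * N - n * \<rho> * P)"
    unfolding 1 2[symmetric] M_def by (simp add: algebra_simps power2_eq_square)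
  finally show ?thesis unfolding A_def B_def C_def M_def .
qed

text \<open>
  The logarithm \<open>D\<close> of the quotient of the two sides vanishes at 0 and 1. The sign of \<open>D'\<close> is that of a
  function \<open>E\<close> with \<open>E(1) = 0\<close> whose derivative is rational, with the sign of a polynomial \<open>f\<close> such that
  \<open>f(\<rho>)/\<rho>\<^sup>3\<close> increases. If \<open>D\<close> were negative somewhere, \<open>E\<close> would be negative, then positive, then 0 at 1,
  so \<open>f\<close> would change sign from positive to negative.
\<close>

lemma power_mean_lower_bound:
  fixes n \<rho> :: real
  assumes n: "n > 1" and \<rho>: "0 \<le> \<rho>" "\<rho> \<le> 1"
  shows "(1 + 2*\<rho>) powr n * (1 + (n - 1)*\<rho> + 2*n*\<rho>^2)
       \<le> (1 + (3*n - 1)*\<rho>) * (1 + 2 * (\<rho> * \<rho> powr (1/n))) powr n"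
proof -
  define m where "m = n - 1"
  have m: "m > 0" and nm: "n = 1 + m" using n by (auto simp: m_def)
  define P where "P = (\<lambda>\<rho>. (2 + 4*m) + (8 + 7*m + 3*m^2) * \<rho> + (8 + 16*m + 6*m^2) * \<rho>^2)"
  define N where "N = (\<lambda>\<rho>. (2 + m) + (8 + 12*m + 4*m^2) * \<rho> + (8 + 18*m + 10*m^2 + 3*m^3) * \<rho>^2
                 + (14*m + 22*m^2 + 6*m^3) * \<rho>^3)"
  define D where "D = (\<lambda>\<rho>. n * ln (1 + 2 * (\<rho> * \<rho> powr (1/n))) - n * ln (1 + 2*\<rho>)
                     + ln (1 + (3*n - 1)*\<rho>) - ln (1 + (n - 1)*\<rho> + 2*n*\<rho>^2))"
  define E where "E = (\<lambda>\<rho>. (1/n - 1) * ln \<rho> + ln (N \<rho>) - ln (P \<rho>) - ln n)"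
  have Ppos: "P u > 0" if "u \<ge> 0" for u
    using that m unfolding P_def by (intro add_pos_nonneg) auto
  have Npos: "N u > 0" if "u \<ge> 0" for u
    using that m unfolding N_def by (intro add_pos_nonneg) auto
  have pos: "1 + 2*u > 0" "1 + (3*n - 1)*u > 0" "1 + (n - 1)*u + 2*n*u^2 > 0"
       "1 + 2 * (u * u powr (1/n)) > 0" if "u \<ge> 0" for u
    using that n by (auto intro!: add_pos_nonneg)
  define f where "f = (\<lambda>u. - (4 + 10*m + 4*m^2) + (2 - m - 13*m^2 - 6*m^3) * u
        - (40 + 76*m + 52*m^2 + 12*m^3) * u^2 + (- 68 - 134*m - 32*m^2 + 27*m^3 + 9*m^4) * u^3
        + (160 + 388*m + 346*m^2 + 168*m^3 + 36*m^4) * u^4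
        + (112 + 400*m + 484*m^2 + 228*m^3 + 36*m^4) * u^5)"
  have E_deriv: "(E has_real_derivative m * f u / (n * u * P u * N u)) (at u)" if u: "u > 0" for u
  proof -
    define P' where "P' = (8 + 7*m + 3*m^2) + (8 + 16*m + 6*m^2) * (2*u)"
    define N' where "N' = (8 + 12*m + 4*m^2) + (8 + 18*m + 10*m^2 + 3*m^3) * (2*u)
         + (14*m + 22*m^2 + 6*m^3) * (3*u^2)"
    have dP: "(P has_real_derivative P') (at u)" unfolding P_def P'_def
      by (auto intro!: derivative_eq_intros)
    have dN: "(N has_real_derivative N') (at u)" unfolding N_def N'_def
      by (auto intro!: derivative_eq_intros)
    have "(E has_real_derivative (1/n - 1) * (1/u) + N' / N u - P' / P u) (at u)"
      unfolding E_def using u Ppos[of u] Npos[of u]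
      by (auto intro!: derivative_eq_intros dP dN)
    also have "(1/n - 1) * (1/u) + N' / N u - P' / P u
       = ((1 - n) * P u * N u + n * u * (N' * P u - P' * N u)) / (n * u * P u * N u)"
      using u Ppos[of u] Npos[of u] n by (simp add: divide_simps) (simp add: algebra_simps)
    also have "(1 - n) * P u * N u + n * u * (N' * P u - P' * N u) = m * f u"
      unfolding f_def P_def N_def P'_def N'_def nm by algebra
    finally show ?thesis .
  qed
  have D_deriv: "(D has_real_derivative 2 * (u powr (1/n) * N u - n * u * P u)
          / ((1 + 2*u*u powr (1/n)) * ((1 + 2*u) * (1 + (3*n - 1)*u) * (1 + (n - 1)*u + 2*n*u^2)))) (at u)"
    if u: "u > 0" for u
  proof -
    define x where "x = u powr (1/n)"
    have x: "x > 0" using u by (simp add: x_def)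
    have dM: "((\<lambda>u. ln (1 + 2 * (u * u powr (1/n)))) has_real_derivative
        (2 * (x + u * (x / n / u))) / (1 + 2 * (u * x))) (at u)"
      using u pos[of u] n
      by (auto intro!: derivative_eq_intros simp: x_def powr_diff divide_simps)
         (simp add: diff_divide_distrib powr_diff)
    have "(D has_real_derivative n * ((2 * (x + u * (x / n / u))) / (1 + 2 * (u * x)))
         - n * (2 / (1 + 2*u)) + (3*n - 1) / (1 + (3*n - 1)*u)
         - (n - 1 + 2*n*(2*u)) / (1 + (n - 1)*u + 2*n*u^2)) (at u)"
      unfolding D_def using u pos[of u]
      by (intro DERIV_add DERIV_diff DERIV_cmult[OF dM] DERIV_cmult)
         (auto intro!: derivative_eq_intros)
    also have "n * ((2 * (x + u * (x / n / u))) / (1 + 2 * (u * x))) = 2*(n+1)*x/(1+2*u*x)"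
    proof -
      have "n * (2 * (x + u * (x / n / u))) = 2 * (n + 1) * x"
        using u n by (simp add: field_simps)
      then show ?thesis by (simp add: mult.assoc)
    qed
    finally have "(D has_real_derivative 2*(n+1)*x/(1+2*u*x)
         - 2 * n / (1 + 2*u) + (3*n - 1) / (1 + (3*n - 1)*u)
         - (n - 1 + 4*n*u) / (1 + (n - 1)*u + 2*n*u^2)) (at u)" by (simp add: algebra_simps)
    then show ?thesis
      using power_mean_deriv_sign[OF m u x] unfolding x_def[symmetric] nm[symmetric] P_def N_def by simp
  qed
  \<comment> \<open>\<open>E\<close> compares the two terms whose difference is the numerator of the
    derivative of \<open>D\<close>. Taking logarithms turns the irrational power into a multiple of
    \<open>ln\<close>, which is why the derivative of \<open>E\<close> is rational.\<close>
  have E_sign: "E u = ln (u powr (1/n) * N u) - ln (n * u * P u)" if "u > 0" for u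
    using that Ppos[of u] Npos[of u] n unfolding E_def
    by (simp add: ln_mult algebra_simps)
  have E1: "E 1 = 0"
  proof -
    have "N 1 = n * P 1" unfolding N_def P_def nm by (simp add: algebra_simps power2_eq_square power3_eq_cube)
    then show ?thesis using Ppos[of 1] n by (simp add: E_def ln_mult)
  qed
  have f_propagates: "f v > 0" if uv: "0 < u" "u < v" "v \<le> 1" and fu: "f u > 0" for u v
  proof -
    \<comment> \<open>Division by \<open>u^3\<close> removes the cubic coefficient, whose sign
      depends on \<open>m\<close>. The constant and quadratic coefficients are negative, the quartic
      and quintic ones positive, so all four give increasing terms. The linear one may be positive
      and is absorbed by the constant one.\<close>
    define g where "g = (\<lambda>u. f u / u^3)"
    define g' where "g' = (\<lambda>u::real. (3 * (4 + 10*m + 4*m^2) - 2 * (2 - m - 13*m^2 - 6*m^3) * u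
        + (40 + 76*m + 52*m^2 + 12*m^3) * u^2) / u^4
        + (160 + 388*m + 346*m^2 + 168*m^3 + 36*m^4)
        + 2 * (112 + 400*m + 484*m^2 + 228*m^3 + 36*m^4) * u)"
    have "(g has_real_derivative g' z) (at z)" if "z > 0" for z
      unfolding g_def g'_def f_def using that
      by (auto intro!: derivative_eq_intros simp: divide_simps)
         (simp add: algebra_simps power2_eq_square power3_eq_cube power4_eq_xxxx eval_nat_numeral)
    moreover have "g' z \<ge> 0" if z: "0 < z" "z \<le> 1" for z
    proof -
      have "0 \<le> 2*m + 26*m^2 + 12*m^3" using m by (intro add_nonneg_nonneg) auto
      then have "2 * (2 - m - 13*m^2 - 6*m^3) \<le> 4" by (simp add: algebra_simps)
      then have "2 * (2 - m - 13*m^2 - 6*m^3) * z \<le> 4 * z"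
        using z by (intro mult_right_mono) auto
      also have "\<dots> \<le> 4" using z by simp
      also have "\<dots> \<le> 3 * (4 + 10*m + 4*m^2)" using m by simp
      finally show ?thesis unfolding g'_def using z m by (auto intro!: add_nonneg_nonneg divide_nonneg_nonneg)
    qed
    ultimately have "\<exists>y. (g has_real_derivative y) (at z) \<and> y \<ge> 0" if "u \<le> z" "z \<le> v" for z
      using uv that by (intro exI[of _ "g' z"]) auto
    then have "g u \<le> g v" using uv by (intro DERIV_nonneg_imp_nondecreasing[of u v g]) auto
    moreover have "g u > 0" using fu uv by (simp add: g_def)
    ultimately have "g v > 0" by simp
    then show ?thesis using uv by (simp add: g_def zero_less_divide_iff)
  qed
  have "D \<rho> \<ge> 0"
  proof (rule ccontr)
    assume neg: "\<not> D \<rho> \<ge> 0"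
    have D0: "D 0 = 0" by (simp add: D_def)
    have D1: "D 1 = 0" using n by (simp add: D_def)
    have r: "0 < \<rho>" "\<rho> < 1" using neg D0 D1 \<rho> by (auto simp: less_le)
    have cont: "continuous_on {0..1} D" unfolding D_def
      using n pos by (intro continuous_intros continuous_on_powr') (auto simp: less_imp_neq[THEN not_sym])
    have sgn: "(E u > 0 \<longleftrightarrow> y > 0) \<and> (E u < 0 \<longleftrightarrow> y < 0)" if u: "u > 0" and y: "DERIV D u :> y" for u y
    proof -
      define S where "S = (1 + 2*u*u powr (1/n)) * ((1 + 2*u) * (1 + (3*n - 1)*u) * (1 + (n - 1)*u + 2*n*u^2))"
      have S: "S > 0" using pos[of u] u unfolding S_def by (auto simp: mult.assoc)
      have yy: "y = 2 * (u powr (1/n) * N u - n * u * P u) / S"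
        using DERIV_unique[OF y D_deriv[OF u]] unfolding S_def .
      have a: "u powr (1/n) * N u > 0" "n * u * P u > 0" using u n Npos[of u] Ppos[of u] by auto
      show ?thesis unfolding E_sign[OF u] yy using S a by (auto simp: zero_less_divide_iff divide_less_0_iff)
    qed
    have diff: "D differentiable (at u)" if "u > 0" for u
      using D_deriv[OF that] real_differentiable_def by blast
    have "\<exists>y u. 0 < u \<and> u < \<rho> \<and> DERIV D u :> y \<and> D \<rho> - D 0 = (\<rho> - 0) * y"
      by (rule MVT) (use r diff in \<open>auto intro: continuous_on_subset[OF cont]\<close>)
    then obtain u y where u: "0 < u" "u < \<rho>" "DERIV D u :> y" "D \<rho> - D 0 = (\<rho> - 0) * y" by blast
    have "\<exists>z v. \<rho> < v \<and> v < 1 \<and> DERIV D v :> z \<and> D 1 - D \<rho> = (1 - \<rho>) * z"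
      by (rule MVT) (use r diff in \<open>auto intro: continuous_on_subset[OF cont]\<close>)
    then obtain v z where v: "\<rho> < v" "v < 1" "DERIV D v :> z" "D 1 - D \<rho> = (1 - \<rho>) * z" by blast
    have "y < 0" using u neg r D0 by (auto simp: not_le mult_less_0_iff)
    then have Eu: "E u < 0" using sgn u by blast
    have "(1 - \<rho>) * z > 0" using v neg D1 by simp
    then have "z > 0" using r by (simp add: zero_less_mult_iff)
    then have Ev: "E v > 0" using sgn v r by fastforce
    obtain a where a: "u < a" "a < v" "E v - E u = (v - u) * (m * f a / (n * a * P a * N a))"
      using MVT2[of u v E "\<lambda>u. m * f u / (n * u * P u * N u)"] E_deriv u v by force
    obtain b where b: "v < b" "b < 1" "E 1 - E v = (1 - v) * (m * f b / (n * b * P b * N b))"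
      using MVT2[of v 1 E "\<lambda>u. m * f u / (n * u * P u * N u)"] E_deriv u v by force
    have ab: "n * a * P a * N a > 0" "n * b * P b * N b > 0"
      using n a b u v Ppos[of a] Ppos[of b] Npos[of a] Npos[of b] by auto
    have "(v - u) * (m * f a / (n * a * P a * N a)) > 0" using a Eu Ev by simp
    then have "f a > 0" using a ab m by (auto simp: zero_less_mult_iff zero_less_divide_iff)
    then have "f b > 0" using f_propagates[of a b] a b u by simp
    then have "(1 - v) * (m * f b / (n * b * P b * N b)) > 0"
      using mult_pos_pos[of "1 - v", OF _ divide_pos_pos[OF mult_pos_pos[OF m \<open>f b > 0\<close>] ab(2)]] v(2)
      by simp
    then show False using b Ev E1 by simp
  qed
  then have "exp (n * ln (1 + 2*\<rho>) + ln (1 + (n - 1)*\<rho> + 2*n*\<rho>^2))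
      \<le> exp (ln (1 + (3*n - 1)*\<rho>) + n * ln (1 + 2 * (\<rho> * \<rho> powr (1/n))))"
    unfolding D_def by simp
  then show ?thesis using pos[OF \<rho>(1)] by (simp add: exp_add powr_def mult.commute)
qed

section \<open>The truncated exponential\<close>

lemma q_0 [simp]: "q 0 = 0" by (simp add: q_def)

lemma q_pos: "x \<noteq> 0 \<Longrightarrow> q x > 0"
  using exp_minus_greater[of "- x"] by (simp add: q_def)

lemma has_derivative_q [derivative_intros]:
  "(q has_real_derivative exp x - 1) (at x)"
  unfolding q_def by (auto intro!: derivative_eq_intros)

lemma deriv_q: "deriv q x = exp x - 1"
  by (rule DERIV_imp_deriv) (rule has_derivative_q)

section \<open>Inequalities for \<open>q\<close> by differentiation\<close>

lemma nonneg_by_deriv: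
  fixes f f' :: "real \<Rightarrow> real"
  assumes "\<And>x. (f has_real_derivative f' x) (at x)" "f 0 = 0" "\<And>x. x \<ge> 0 \<Longrightarrow> f' x \<ge> 0" "x \<ge> 0"
  shows "f x \<ge> 0"
proof -
  have "f 0 \<le> f x" using assms by (intro DERIV_nonneg_imp_nondecreasing[of 0 x f]) blast+
  then show ?thesis using assms by simp
qed

text \<open>Times \<open>exp x\<close>, this is the numerator of the second derivative of
  \<open>x^2 / q x\<close>. The expression and its first four derivatives vanish at 0 and the fifth
  is nonnegative; the facts below are numbered by order of derivative.\<close>

lemma convexity_numerator_nonneg:
  fixes x :: real
  assumes "x \<ge> 0"
  shows "(x^2 - 4*x + 2) * exp x + x^3 + x^2 + 4*x - 4 + 2 * exp (-x) \<ge> 0"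
proof -
  have 5: "(x^2 + 6*x + 2) * exp x - 2 * exp (-x) \<ge> 0" if "x \<ge> 0" for x :: real
  proof -
    have "2 * exp (-x) \<le> 2 * exp x" using that by simp
    also have "\<dots> \<le> (x^2 + 6*x + 2) * exp x" using that by (intro mult_right_mono) auto
    finally show ?thesis by simp
  qed
  have 4: "(x^2 + 4*x - 2) * exp x + 2 * exp (-x) \<ge> 0" if "x \<ge> 0" for x :: real
    by (rule nonneg_by_deriv[OF _ _ 5 that]) (auto intro!: derivative_eq_intros simp: algebra_simps)
  have 3: "(x^2 + 2*x - 4) * exp x + 6 - 2 * exp (-x) \<ge> 0" if "x \<ge> 0" for x :: real
    by (rule nonneg_by_deriv[OF _ _ 4 that]) (auto intro!: derivative_eq_intros simp: algebra_simps)
  have 2: "(x^2 - 4) * exp x + 6*x + 2 + 2 * exp (-x) \<ge> 0" if "x \<ge> 0" for x :: real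
    by (rule nonneg_by_deriv[OF _ _ 3 that]) (auto intro!: derivative_eq_intros simp: algebra_simps)
  have 1: "(x^2 - 2*x - 2) * exp x + 3*x^2 + 2*x + 4 - 2 * exp (-x) \<ge> 0" if "x \<ge> 0" for x :: real
    by (rule nonneg_by_deriv[OF _ _ 2 that]) (auto intro!: derivative_eq_intros simp: algebra_simps)
  show ?thesis
    by (rule nonneg_by_deriv[OF _ _ 1 assms]) (auto intro!: derivative_eq_intros simp: algebra_simps power2_eq_square)
qed

text \<open>The right side is the tangent at \<open>s\<close> of the function
  \<open>u^2 / q u\<close>, which is convex for positive arguments.\<close>

lemma square_over_q_above_tangent:
  assumes "s > 0" "u > 0"
  shows "u^2 / q u \<ge> s^2 / q s + (2 * s * q s - s^2 * (exp s - 1)) / (q s)^2 * (u - s)"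
proof -
  define f' where "f' = (\<lambda>x. (2 * x * q x - x^2 * (exp x - 1)) / (q x)^2)"
  define f'' where "f'' = (\<lambda>x. (2 * (q x)^2 - x^2 * q x * exp x - 4 * x * q x * (exp x - 1)
        + 2 * x^2 * (exp x - 1)^2) / (q x)^3)"
  have f': "((\<lambda>x. x^2 / q x) has_real_derivative f' x) (at x)" if "x > 0" for x
    unfolding f'_def using q_pos[of x] that
    by (auto intro!: derivative_eq_intros simp: power2_eq_square)
  have f'': "(f' has_real_derivative f'' x) (at x)" if "x > 0" for x
    unfolding f'_def f''_def using q_pos[of x] that
    by (auto intro!: derivative_eq_intros simp: divide_simps)
       (simp add: algebra_simps power2_eq_square power3_eq_cube power4_eq_xxxx)
  have f''_nonneg: "f'' x \<ge> 0" if "x > 0" for x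
  proof -
    have e: "exp x * exp (-x) = 1" by (simp add: exp_minus)
    have "2 * (q x)^2 - x^2 * q x * exp x - 4 * x * q x * (exp x - 1) + 2 * x^2 * (exp x - 1)^2
      = exp x * ((x^2 - 4*x + 2) * exp x + x^3 + x^2 + 4*x - 4 + 2 * exp (-x))"
      unfolding q_def using e by algebra
    also have "\<dots> \<ge> 0" using convexity_numerator_nonneg[of x] that by simp
    finally show ?thesis unfolding f''_def using q_pos[of x] that by simp
  qed
  have "convex_on {0<..} (\<lambda>x. x^2 / q x)"
    by (rule f''_ge0_imp_convex[OF _ f' f'' f''_nonneg]) auto
  then have "f' s * (u - s) \<le> u^2 / q u - s^2 / q s"
    using assms by (intro convex_on_imp_above_tangent[where A = "{0<..}"])
      (auto intro: has_field_derivative_at_within f' simp: interior_open)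
  then show ?thesis unfolding f'_def by simp
qed

text \<open>At \<open>u = s * y\<close> the tangent at \<open>s\<close> takes the value
  \<open>s^2 / q s * (1 + (Q s - 2) * (1 - y))\<close>. This is positive because
  \<open>Q s \<ge> 2\<close>, so the tangent bound can be inverted.\<close>

lemma q_scaled_upper_bound:
  assumes s: "s > 0" and K: "Q s \<ge> 2" and y: "0 \<le> y" "y \<le> 1"
  shows "q (s * y) \<le> q s * (y^2 / (1 + (Q s - 2) * (1 - y)))"
proof (cases "y = 0")
  case False
  then have y0: "y > 0" using y by simp
  define d where "d = 1 + (Q s - 2) * (1 - y)"
  have d: "d > 0" using K y unfolding d_def by (intro add_pos_nonneg) auto
  have qs: "q s > 0" "q (s*y) > 0" using s y0 by (auto intro: q_pos)
  have Qs: "Q s * q s = s * (exp s - 1)" using qs by (simp add: Q_def deriv_q)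
  have "s^2 / q s * d = s^2 / q s + (2 * s * q s - s * (Q s * q s)) / (q s)^2 * (s*y - s)"
    unfolding d_def using qs by (simp add: field_simps power2_eq_square)
  also have "\<dots> \<le> (s*y)^2 / q (s*y)"
    using square_over_q_above_tangent[of s "s*y"] s y0 unfolding Qs by (simp add: power2_eq_square mult.assoc)
  finally have "s^2 * (d / q s) \<le> s^2 * (y^2 / q (s*y))" by (simp add: power_mult_distrib)
  then have "d / q s \<le> y^2 / q (s*y)" by (rule mult_left_le_imp_le) (use s in simp)
  then show ?thesis unfolding d_def[symmetric] using qs d by (simp add: field_simps)
qed auto

text \<open>For positive \<open>d\<close> the quotient \<open>q x / x^2\<close> is increasing. For
  the other \<open>d\<close> its limit 1/2 at 0 separates the two sides:
  \<open>q (-x) \<le> x^2 / 2 \<le> q x\<close> for \<open>x \<ge> 0\<close>. Cross-multiplication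
  lets \<open>d = 0\<close> be included.\<close>

lemma q_over_square_mono:
  assumes "d \<le> D" "D > 0"
  shows "q d * D^2 \<le> q D * d^2"
proof -
  define g where "g = (\<lambda>x. q x / x^2)"
  have half: "x^2 / 2 \<le> q x" if "x \<ge> 0" for x
    using exp_lower_Taylor_quadratic[OF that] by (simp add: q_def)
  show ?thesis
  proof (cases "d > 0")
    case True
    define m where "m = (\<lambda>x::real. x * (exp x + 1) - 2 * (exp x - 1))"
    have m': "x * exp x - exp x + 1 \<ge> 0" if "x \<ge> 0" for x :: real
      by (rule nonneg_by_deriv[where f' = "\<lambda>x. x * exp x", OF _ _ _ that])
         (auto intro!: derivative_eq_intros simp: algebra_simps)
    have m: "m x \<ge> 0" if "x \<ge> 0" for x
      unfolding m_def
      by (rule nonneg_by_deriv[OF _ _ m' that]) (auto intro!: derivative_eq_intros simp: algebra_simps)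
    have "(g has_real_derivative m x / x^3) (at x)" if "x > 0" for x
      unfolding g_def m_def using that
      by (auto intro!: derivative_eq_intros simp: divide_simps)
         (simp add: q_def algebra_simps power2_eq_square power3_eq_cube power4_eq_xxxx)
    moreover have "m x / x^3 \<ge> 0" if "x > 0" for x using m[of x] that by simp
    ultimately have "\<exists>y. (g has_real_derivative y) (at x) \<and> y \<ge> 0" if "d \<le> x" for x
      using True that by (intro exI[of _ "m x / x^3"]) auto
    then have "g d \<le> g D" using assms by (intro DERIV_nonneg_imp_nondecreasing[of d D g]) auto
    then show ?thesis using True assms by (simp add: g_def field_simps)
  next
    case False
    have "q (-x) \<le> x^2 / 2" if "x \<ge> 0" for x
    proof -
      have "x - 1 + exp (-x) \<ge> 0" for x :: real
        using exp_ge_add_one_self[of "-x"] by simp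
      then have "x^2/2 - q (-x) \<ge> 0"
        by (intro nonneg_by_deriv[where f = "\<lambda>x. x^2/2 - q (-x)" and f' = "\<lambda>x. x - 1 + exp (-x)", OF _ _ _ that])
           (auto intro!: derivative_eq_intros simp: q_def)
      then show ?thesis by simp
    qed
    from this[of "-d"] False have "q d * D^2 \<le> d^2 / 2 * D^2" by (intro mult_right_mono) auto
    also have "\<dots> = D^2 / 2 * d^2" by simp
    also have "\<dots> \<le> q D * d^2" using half[of D] assms by (intro mult_right_mono) auto
    finally show ?thesis .
  qed
qed

text \<open>Majorise \<open>q\<close> by the quadratic that touches it at \<open>v\<close> and meets it at \<open>s\<close>.\<close>

lemma sum_q_le_extremal:
  assumes u: "\<And>i. i \<le> (2::nat) \<Longrightarrow> u i \<le> s" and vs: "v \<le> s"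
    and s1: "(\<Sum>i\<le>2. u i - v) = s - v" and s2: "(\<Sum>i\<le>2. (u i - v)^2) = (s - v)^2"
  shows "(\<Sum>i\<le>2. q (u i)) \<le> q s + 2 * q v"
proof (cases "v = s")
  case True
  then have "u i = v" if "i \<le> 2" for i
    using s2 that by (auto simp: sum_nonneg_eq_0_iff)
  then show ?thesis using True by simp
next
  case False
  then have sv: "s - v > 0" using vs by simp
  define \<kappa> where "\<kappa> = exp v * q (s - v) / (s - v)^2"
  \<comment> \<open>An exact expansion about \<open>v\<close>: the remainder is again a multiple of
    \<open>q\<close>, so replacing it by a quadratic is a matter of the growth of
    \<open>q z / z^2\<close>. The constant \<kappa> makes the quadratic exact at
    \<open>s\<close>.\<close>
  have shift: "q z = q v + (exp v - 1) * (z - v) + exp v * q (z - v)" for z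
    unfolding q_def by (simp add: exp_diff algebra_simps)
  have "q (u i) \<le> q v + (exp v - 1) * (u i - v) + \<kappa> * (u i - v)^2" if "i \<le> 2" for i
  proof -
    have "q (u i - v) \<le> q (s - v) / (s - v)^2 * (u i - v)^2"
      using q_over_square_mono[of "u i - v" "s - v"] u[OF that] sv by (simp add: field_simps)
    then have "exp v * q (u i - v) \<le> exp v * (q (s - v) / (s - v)^2 * (u i - v)^2)"
      by (rule mult_left_mono) simp
    also have "\<dots> = \<kappa> * (u i - v)^2" by (simp add: \<kappa>_def)
    finally have "exp v * q (u i - v) \<le> \<kappa> * (u i - v)^2" .
    then show ?thesis by (subst shift[of "u i"]) simp
  qed
  then have "(\<Sum>i\<le>2. q (u i)) \<le> (\<Sum>i\<le>2. q v + (exp v - 1) * (u i - v) + \<kappa> * (u i - v)^2)"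
    by (intro sum_mono) auto
  \<comment> \<open>The first two moments about \<open>v\<close> agree with those of the triple
    \<open>(s, v, v)\<close>, at which the quadratic is exact.\<close>
  also have "\<dots> = 3 * q v + (exp v - 1) * (s - v) + \<kappa> * (s - v)^2"
    by (simp only: sum.distrib sum_distrib_left[symmetric] s1 s2) simp
  also have "\<kappa> * (s - v)^2 = exp v * q (s - v)" using sv by (simp add: \<kappa>_def)
  also have "3 * q v + (exp v - 1) * (s - v) + exp v * q (s - v) = q s + 2 * q v"
    using shift[of s] by simp
  finally show ?thesis .
qed

section \<open>Fourier bound and weighted means\<close>

lemma sum_atMost_2: "(\<Sum>i\<le>2. f i) = f 0 + f 1 + f (2::nat)"
  by (simp add: numeral_2_eq_2)

lemma all_atMost_2: "(\<forall>i\<le>2. P i) \<longleftrightarrow> P 0 \<and> P 1 \<and> P (2::nat)"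
  by (auto simp: le_Suc_eq numeral_2_eq_2)

section \<open>Characters modulo 3\<close>

definition cube_root_unity :: complex where
  "cube_root_unity = Complex (-1/2) (sqrt 3 / 2)"

lemma cube_root_unity_power2: "cube_root_unity ^ 2 = Complex (-1/2) (- sqrt 3 / 2)"
  by (simp add: cube_root_unity_def power2_eq_square complex_eq_iff)

lemma cube_root_unity_power3: "cube_root_unity ^ 3 = 1"
proof -
  have "cube_root_unity ^ 3 = cube_root_unity ^ 2 * cube_root_unity" by (simp add: power3_eq_cube power2_eq_square)
  also have "\<dots> = 1"
    unfolding cube_root_unity_power2 by (simp add: cube_root_unity_def complex_eq_iff)
  finally show ?thesis .
qed

lemma cube_root_unity_power_mod: "cube_root_unity ^ j = cube_root_unity ^ (j mod 3)"
proof -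
  have "cube_root_unity ^ j = cube_root_unity ^ (3 * (j div 3) + j mod 3)" by simp
  also have "\<dots> = cube_root_unity ^ (j mod 3)"
    unfolding power_add power_mult cube_root_unity_power3 by simp
  finally show ?thesis .
qed

text \<open>Orthogonality of characters: modulo 3 the exponents are \<open>j - l\<close> and its
  negative. After reduction to residues nine cases remain.\<close>

lemma cube_root_unity_character_sum:
  "1 + cube_root_unity ^ (j + 2 * l) + cube_root_unity ^ (2 * j + l) = (if j mod 3 = l mod 3 then 3 else 0)"
proof -
  have root: "cube_root_unity ^ (j + 2 * l) = cube_root_unity ^ (j mod 3) * (cube_root_unity ^ (l mod 3))^2"
    "cube_root_unity ^ (2 * j + l) = (cube_root_unity ^ (j mod 3))^2 * cube_root_unity ^ (l mod 3)"
    unfolding cube_root_unity_power_mod[of j, symmetric] cube_root_unity_power_mod[of l, symmetric]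
    by (simp_all add: power_add power_mult[symmetric] mult.commute)
  have "j mod 3 \<in> {0, 1, 2}" "l mod 3 \<in> {0, 1, 2}" by auto
  then show ?thesis unfolding root
    by (auto simp: cube_root_unity_power2) (auto simp: cube_root_unity_def complex_eq_iff power2_eq_square)
qed

lemma trinomial_theorem:
  fixes a b c :: complex
  shows "(a + b + c) ^ k = (\<Sum>(k0, k1, k2) \<in> {(k0, k1, k2). k0 + k1 + k2 = k}.
    complex_of_real (fact k / (fact k0 * fact k1 * fact k2)) * (a ^ k0 * b ^ k1 * c ^ k2))"
proof -
  have "(a + b + c) ^ k = (\<Sum>i\<le>k. of_nat (k choose i) * a ^ i * (b + c) ^ (k - i))"
    unfolding add.assoc by (rule binomial_ring)
  also have "\<dots> = (\<Sum>i\<le>k. \<Sum>j\<le>k - i. of_nat (k choose i) * a ^ i *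
      (of_nat ((k - i) choose j) * b ^ j * c ^ (k - i - j)))"
    by (subst binomial_ring) (simp add: sum_distrib_left)
  also have "\<dots> = (\<Sum>(i, j)\<in>Sigma {..k} (\<lambda>i. {..k - i}). of_nat (k choose i) * a ^ i *
      (of_nat ((k - i) choose j) * b ^ j * c ^ (k - i - j)))"
    by (subst sum.Sigma) auto
  also have "\<dots> = (\<Sum>(k0, k1, k2) \<in> {(k0, k1, k2). k0 + k1 + k2 = k}.
    complex_of_real (fact k / (fact k0 * fact k1 * fact k2)) * (a ^ k0 * b ^ k1 * c ^ k2))"
    by (rule sum.reindex_bij_witness[where i = "\<lambda>(k0, k1, k2). (k0, k1)" and j = "\<lambda>(i, j). (i, j, k - i - j)"])
       (auto simp: binomial_fact mult.assoc)
  finally show ?thesis .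
qed

text \<open>Averaging the \<open>k\<close>-th powers of the three Fourier coefficients of
  \<open>c\<close> selects exactly the terms with \<open>k1\<close> and \<open>k2\<close> congruent
  modulo 3. The triangle inequality then applies; the two nontrivial coefficients are conjugate, and
  the square root is their common modulus.\<close>

lemma r_le_Fourier:
  assumes "\<And>i. c i \<ge> 0"
  shows "r k c \<le> ((c 0 + c 1 + c 2) ^ k
     + 2 * sqrt ((c 0)^2 + (c 1)^2 + (c 2)^2 - c 0 * c 1 - c 0 * c 2 - c 1 * c 2) ^ k) / 3"
proof -
  define T where "T = {(k0, k1, k2). k0 + k1 + k2 = k}"
  define w where "w = cube_root_unity"
  define C :: "nat \<Rightarrow> complex" where "C = (\<lambda>i. complex_of_real (c i))"
  define t where "t = (\<lambda>(k0, k1, k2). complex_of_real (fact k / (fact k0 * fact k1 * fact k2)) *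
      (C 0 ^ k0 * C 1 ^ k1 * C 2 ^ k2))"
  have finT: "finite T"
    by (rule finite_subset[of _ "{..k} \<times> {..k} \<times> {..k}"]) (auto simp: T_def)
  have sqrt3: "sqrt 3 * (sqrt 3 * z) = 3 * z" for z :: real by (simp add: mult.assoc[symmetric])
  have w4: "w ^ 4 = w" unfolding w_def by (subst cube_root_unity_power_mod) simp
  have "(C 0 + C 1 + C 2) ^ k + (C 0 + w * C 1 + w^2 * C 2) ^ k + (C 0 + w^2 * C 1 + w^4 * C 2) ^ k
     = (\<Sum>(k0, k1, k2)\<in>T. t (k0, k1, k2) * (1 + w ^ (k1 + 2 * k2) + w ^ (2 * k1 + 4 * k2)))"
    unfolding trinomial_theorem T_def[symmetric] sum.distrib[symmetric]
    by (intro sum.cong) (auto simp: t_def algebra_simps power_add power_mult[symmetric] add_divide_distrib)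
  also have "\<dots> = (\<Sum>(k0, k1, k2)\<in>T. if k1 mod 3 = k2 mod 3 then 3 * t (k0, k1, k2) else 0)"
  proof (intro sum.cong refl, clarify)
    fix k0 k1 k2
    have "w ^ (2 * k1 + 4 * k2) = w ^ (2 * k1 + k2)"
      using w4 by (simp add: power_add power_mult)
    then show "t (k0, k1, k2) * (1 + w ^ (k1 + 2 * k2) + w ^ (2 * k1 + 4 * k2)) =
       (if k1 mod 3 = k2 mod 3 then 3 * t (k0, k1, k2) else 0)"
      using cube_root_unity_character_sum[of k1 k2] by (simp add: w_def)
  qed
  also have "\<dots> = (\<Sum>(k0, k1, k2)\<in>{(k0, k1, k2). k0 + k1 + k2 = k \<and> k1 mod 3 = k2 mod 3}. 3 * t (k0, k1, k2))"
    using finT by (intro sum.mono_neutral_cong_right) (auto simp: T_def split: if_splits)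
  also have "\<dots> = complex_of_real (3 * r k c)"
    unfolding r_def t_def C_def of_real_mult of_real_sum sum_distrib_left
    by (intro sum.cong) (auto simp: algebra_simps)
  finally have eq: "complex_of_real (3 * r k c) = (C 0 + C 1 + C 2) ^ k
      + (C 0 + w * C 1 + w^2 * C 2) ^ k + (C 0 + w^2 * C 1 + w^4 * C 2) ^ k" by simp
  have "r k c \<ge> 0" unfolding r_def using assms by (intro sum_nonneg) auto
  then have "3 * r k c = cmod (complex_of_real (3 * r k c))" by simp
  also have "\<dots> \<le> cmod (C 0 + C 1 + C 2) ^ k + cmod (C 0 + w * C 1 + w^2 * C 2) ^ k
       + cmod (C 0 + w^2 * C 1 + w^4 * C 2) ^ k"
    unfolding eq norm_power[symmetric] by (intro order_trans[OF norm_triangle_ineq] add_right_mono norm_triangle_ineq)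
  also have "cmod (C 0 + C 1 + C 2) = c 0 + c 1 + c 2"
    using assms unfolding C_def of_real_add[symmetric] norm_of_real by simp
  also have "cmod (C 0 + w * C 1 + w^2 * C 2)
     = sqrt ((c 0)^2 + (c 1)^2 + (c 2)^2 - c 0 * c 1 - c 0 * c 2 - c 1 * c 2)"
    unfolding cmod_def w_def cube_root_unity_power2
    by (simp add: C_def cube_root_unity_def) (simp add: power2_eq_square algebra_simps sqrt3)
  also have "cmod (C 0 + w^2 * C 1 + w^4 * C 2)
     = sqrt ((c 0)^2 + (c 1)^2 + (c 2)^2 - c 0 * c 1 - c 0 * c 2 - c 1 * c 2)"
    unfolding cmod_def w4 unfolding w_def cube_root_unity_power2
    by (simp add: C_def cube_root_unity_def) (simp add: power2_eq_square algebra_simps sqrt3)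
  finally show ?thesis by simp
qed

text \<open>Weighted AM-GM, from \<open>ln z \<le> z - 1\<close> at
  \<open>z = Z i / (\<omega> i * M)\<close>. The exponents add up to \<open>ln M\<close>, since
  \<open>Z i / M\<close> and \<open>\<omega> i\<close> both sum to 1. A zero weight contributes a
  factor 1 by the convention in \<open>cpow\<close>.\<close>

lemma Gibbs_cpow:
  assumes Z: "\<And>i. i \<le> (2::nat) \<Longrightarrow> Z i > 0" and \<omega>: "\<And>i. i \<le> 2 \<Longrightarrow> \<omega> i \<ge> 0" "(\<Sum>i\<le>2. \<omega> i) = 1"
  shows "(\<Prod>i\<le>2. cpow (Z i / \<omega> i) (\<omega> i)) \<le> (\<Sum>i\<le>2. Z i)"
proof -
  define M where "M = (\<Sum>i\<le>2. Z i)"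
  have M: "M > 0" unfolding M_def using Z by (intro sum_pos) auto
  have "cpow (Z i / \<omega> i) (\<omega> i) \<le> exp (\<omega> i * ln M + Z i / M - \<omega> i)" if i: "i \<le> 2" for i
  proof (cases "\<omega> i = 0")
    case True
    then show ?thesis using Z[OF i] M by (simp add: cpow_def)
  next
    case False
    then have w: "\<omega> i > 0" using \<omega>(1)[OF i] by simp
    have "ln (Z i / \<omega> i) - ln M = ln (Z i / \<omega> i / M)" using Z[OF i] w M by (subst ln_div) auto
    also have "\<dots> \<le> Z i / \<omega> i / M - 1" using Z[OF i] w M by (intro ln_le_minus_one) simp
    finally have "\<omega> i * ln (Z i / \<omega> i) \<le> \<omega> i * (ln M + Z i / \<omega> i / M - 1)"
      using w by (intro mult_left_mono) auto
    also have "\<dots> = \<omega> i * ln M + Z i / M - \<omega> i" using w by (simp add: algebra_simps)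
    finally show ?thesis using w Z[OF i] by (simp add: cpow_def powr_def)
  qed
  then have "(\<Prod>i\<le>2. cpow (Z i / \<omega> i) (\<omega> i)) \<le> (\<Prod>i\<le>2. exp (\<omega> i * ln M + Z i / M - \<omega> i))"
    by (intro prod_mono) (auto simp: cpow_def)
  also have "\<dots> = exp (\<Sum>i\<le>2. \<omega> i * ln M + Z i / M - \<omega> i)" by (simp add: exp_sum)
  also have "(\<Sum>i\<le>2. \<omega> i * ln M + Z i / M - \<omega> i) = ln M"
    using M \<omega>(2) by (simp add: sum.distrib sum_subtractf sum_distrib_right[symmetric]
        sum_divide_distrib[symmetric] M_def)
  also have "exp (ln M) = M" using M by simp
  finally show ?thesis unfolding M_def .
qed

section \<open>Stationary weights\<close>

text \<open>
  Fixed point of \<open>c\<^sub>i \<mapsto> c\<^sub>i + (\<lambda>\<^sub>i (1 + 2x\<^sup>k) - c\<^sub>i w\<^sub>i)/3\<close>. It preserves the simplex because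
  \<open>\<Sum> c\<^sub>i w\<^sub>i = 1 + 2x\<^sup>k\<close> and \<open>w\<^sub>i \<le> 3\<close>.
\<close>

lemma stationary_weights_exist:
  fixes l0 l1 l2 :: real
  assumes k: "k \<ge> (3::nat)" and l: "l0 > 0" "l1 > 0" "l2 > 0" "l0 + l1 + l2 = 1"
  obtains c0 c1 c2 x :: real where "c0 > 0" "c1 > 0" "c2 > 0" "c0 + c1 + c2 = 1" "0 \<le> x" "x \<le> 1"
    "2 * x^2 = 3 * (c0^2 + c1^2 + c2^2) - 1"
    "l0 * (1 + 2 * x^k) = c0 * (1 + x^(k-2) * (3*c0 - 1))"
    "l1 * (1 + 2 * x^k) = c1 * (1 + x^(k-2) * (3*c1 - 1))"
    "l2 * (1 + 2 * x^k) = c2 * (1 + x^(k-2) * (3*c2 - 1))"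
proof -
  \<comment> \<open>The simplex in the coordinates \<open>(c1, c2)\<close>, with
    \<open>c0 = 1 - c1 - c2\<close>; \<open>X\<close> is the modulus of the nontrivial Fourier
    coefficient.\<close>
  define S :: "(real \<times> real) set" where "S = {p. 0 \<le> fst p \<and> 0 \<le> snd p \<and> fst p + snd p \<le> 1}"
  define X :: "real \<times> real \<Rightarrow> real"
    where "X = (\<lambda>(u, v). sqrt ((3 * ((1 - u - v)^2 + u^2 + v^2) - 1) / 2))"
  define W where "W = (\<lambda>p u. 1 + X p ^ (k-2) * (3*u - 1))"
  define F where "F = (\<lambda>p. (fst p + (l1 * (1 + 2 * X p ^ k) - fst p * W p (fst p)) / 3,
                            snd p + (l2 * (1 + 2 * X p ^ k) - snd p * W p (snd p)) / 3))"
  have radicand: "3 * ((1 - u - v)^2 + u^2 + v^2) - 1 \<ge> 0" for u v :: real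
  proof -
    have "3 * ((1 - u - v)^2 + u^2 + v^2) - 1 = ((1 - 3*u)^2 + (1 - 3 * v)^2 + (3*u + 3 * v - 2)^2) / 3"
      by (simp add: power2_eq_square algebra_simps)
    also have "\<dots> \<ge> 0" by simp
    finally show ?thesis .
  qed
  have X2: "2 * X (u, v)^2 = 3 * ((1 - u - v)^2 + u^2 + v^2) - 1" for u v
    unfolding X_def using radicand[of u v] by (simp del: diff_ge_0_iff_ge)
  have X0: "X p \<ge> 0" for p
    unfolding X_def using radicand by (cases p) (simp del: diff_ge_0_iff_ge)
  have X1: "X (u, v) \<le> 1" if "(u, v) \<in> S" for u v
  proof -
    have "0 \<le> u * v" "0 \<le> u * (1 - u - v)" "0 \<le> v * (1 - u - v)" using that by (auto simp: S_def)
    then have "X (u, v)^2 \<le> 1" using X2[of u v] by (simp add: power2_eq_square algebra_simps)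
    then show ?thesis by (simp add: abs_square_le_1 X0)
  qed
  \<comment> \<open>Since the coordinates sum to 1, the left side is \<open>1 + x^(k-2)\<close>
    times \<open>3 * (c0^2 + c1^2 + c2^2) - 1\<close>, which is \<open>2 * x^2\<close>.\<close>
  have weights: "(1 - u - v) * W (u, v) (1 - u - v) + u * W (u, v) u + v * W (u, v) v = 1 + 2 * X (u, v)^k" for u v
  proof -
    have "X (u, v)^k = X (u, v)^(k - 2 + 2)"
      by (rule arg_cong[where f = "\<lambda>j. X (u, v)^j"]) (use k in simp)
    also have "\<dots> = X (u, v)^(k-2) * X (u, v)^2" by (rule power_add)
    finally have "1 + 2 * X (u, v)^k = 1 + X (u, v)^(k-2) * (2 * X (u, v)^2)" by simp
    moreover have "(1 - u - v) * (1 + z * (3 * (1 - u - v) - 1)) + u * (1 + z * (3 * u - 1)) + v * (1 + z * (3 * v - 1))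
       = 1 + z * (3 * ((1 - u - v)^2 + u^2 + v^2) - 1)" for z :: real by algebra
    ultimately show ?thesis unfolding X2 W_def by simp
  qed
  have step: "u + (l * (1 + 2 * X p ^ k) - u * W p u) / 3 \<ge> 0" if "0 \<le> u" "u \<le> 1" "l \<ge> 0" "p \<in> S" for u l p
  proof -
    have "X p ^ (k-2) * (3*u - 1) \<le> 1 * 2"
    proof (cases "3*u - 1 \<ge> 0")
      case True
      then show ?thesis using that X0[of p] X1[of "fst p" "snd p"]
        by (intro mult_mono) (auto intro: power_le_one)
    next
      case False
      then have "X p ^ (k-2) * (3*u - 1) \<le> 0" using X0[of p] by (intro mult_nonneg_nonpos) auto
      then show ?thesis by simp
    qed
    then have "u * W p u \<le> u * 3" unfolding W_def using that by (intro mult_left_mono) auto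
    moreover have "l * (1 + 2 * X p ^ k) \<ge> 0" using that X0[of p] by simp
    moreover have "0 \<le> u + (A - B) / 3" if "B \<le> u * 3" "0 \<le> A" for A B
      using that by (simp add: field_simps)
    ultimately show ?thesis by blast
  qed
  have "\<exists>p\<in>S. F p = p"
  proof (rule brouwer)
    have "closed S" unfolding S_def
      by (intro closed_Collect_conj closed_Collect_le continuous_intros)
    moreover have "bounded S"
      by (rule bounded_subset[OF bounded_cbox[of "(0,0)" "(1,1)"]]) (auto simp: S_def cbox_Pair_eq)
    ultimately show "compact S" by (simp add: compact_eq_bounded_closed)
    show "convex S"
    proof (rule convexI)
      fix p p' and a b :: real assume p: "p \<in> S" "p' \<in> S" and ab: "0 \<le> a" "0 \<le> b" "a + b = 1"
      have "a * (fst p + snd p) + b * (fst p' + snd p') \<le> 1"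
        using p ab by (intro convex_bound_le) (auto simp: S_def)
      then show "a *\<^sub>R p + b *\<^sub>R p' \<in> S" using p ab by (auto simp: S_def algebra_simps)
    qed
    have "(0, 0) \<in> S" by (simp add: S_def)
    then show "S \<noteq> {}" by blast
    have "continuous_on S X" unfolding X_def case_prod_beta by (intro continuous_intros) simp
    then show "continuous_on S F" unfolding F_def W_def by (intro continuous_intros) simp_all
    show "F \<in> S \<rightarrow> S"
    proof
      fix p assume p: "p \<in> S"
      obtain u v where uv: "p = (u, v)" by fastforce
      \<comment> \<open>The old and new weights have the same total, so the implicit coordinate is
        updated by the same formula as the other two and \<open>step\<close> covers it as
        well.\<close>
      have regroup: "1 - (u + (A1 - B1) / 3) - (v + (A2 - B2) / 3) = (1 - u - v) + (A0 - B0) / 3"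
        if "B0 + B1 + B2 = A0 + A1 + A2" for A0 A1 A2 B0 B1 B2 :: real
        using that by (simp add: field_simps)
      have "1 - fst (F p) - snd (F p) = (1 - u - v) + (l0 * (1 + 2 * X p ^ k) - (1 - u - v) * W p (1 - u - v)) / 3"
        unfolding F_def uv fst_conv snd_conv
        by (rule regroup) (simp only: weights distrib_right[symmetric] l(4) mult_1)
      also have "\<dots> \<ge> 0" using p l uv by (intro step) (auto simp: S_def)
      finally show "F p \<in> S" using p l step[of u l1 p] step[of v l2 p]
        unfolding S_def F_def uv by auto
    qed
  qed blast
  then obtain u v where uv: "(u, v) \<in> S" "F (u, v) = (u, v)" by fastforce
  define x where "x = X (u, v)"
  have x: "0 \<le> x" "x \<le> 1" using X0 X1[OF uv(1)] by (auto simp: x_def)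
  have e1: "l1 * (1 + 2 * x^k) = u * (1 + x^(k-2) * (3*u - 1))"
   and e2: "l2 * (1 + 2 * x^k) = v * (1 + x^(k-2) * (3 * v - 1))"
    using uv(2) unfolding F_def W_def x_def by auto
  have e0: "l0 * (1 + 2 * x^k) = (1 - u - v) * (1 + x^(k-2) * (3*(1 - u - v) - 1))"
  proof -
    have l0: "l0 = 1 - l1 - l2" using l(4) by simp
    have "l0 * (1 + 2 * x^k) = (1 + 2 * x^k) - l1 * (1 + 2 * x^k) - l2 * (1 + 2 * x^k)"
      unfolding l0 by (simp only: left_diff_distrib mult_1)
    then show ?thesis unfolding e1 e2 using weights[of u v] unfolding W_def x_def by simp
  qed
  have xk: "1 + 2 * x^k > 0" using x by (simp add: add_pos_nonneg)
  have nz: "c > 0" if "c \<ge> 0" "l * (1 + 2 * x^k) = c * z" "l > 0" for c l z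
    using that xk by (cases "c = 0") auto
  show thesis
  proof (rule that[of "1 - u - v" u v x])
    show "1 - u - v > 0" "u > 0" "v > 0"
      using nz[OF _ e0] nz[OF _ e1] nz[OF _ e2] l uv(1) by (auto simp: S_def)
  qed (use x e0 e1 e2 X2[of u v] in \<open>auto simp: x_def\<close>)
qed

section \<open>The bound on \<open>Psi\<close>\<close>

text \<open>If \<open>a + b + c = 0\<close>, then \<open>b^2 + c^2 \<ge> a^2 / 2\<close>, so
  \<open>a^2\<close> is at most two thirds of the sum of squares. The extreme case is
  \<open>(2\<rho>, -\<rho>, -\<rho>)\<close>.\<close>

lemma abs_le_of_centered:
  fixes d :: "nat \<Rightarrow> real"
  assumes "(\<Sum>i\<le>2. d i) = 0" "(\<Sum>i\<le>2. (d i)^2) = 6 * \<rho>^2" "\<rho> \<ge> 0" "i \<le> 2"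
  shows "\<bar>d i\<bar> \<le> 2 * \<rho>"
proof -
  have *: "\<bar>a\<bar> \<le> 2 * \<rho>" if "a + b + c = 0" "a^2 + b^2 + c^2 = 6 * \<rho>^2" for a b c :: real
  proof -
    have a: "a = - (b + c)" using that(1) by simp
    have "3 * a^2 + (b - c)^2 = 2 * (a^2 + b^2 + c^2)" unfolding a by (simp add: power2_eq_square algebra_simps)
    then have "3 * a^2 \<le> 2 * (a^2 + b^2 + c^2)" using zero_le_power2[of "b - c"] by linarith
    then have "a^2 \<le> (2 * \<rho>)^2" unfolding that(2) by (simp add: power_mult_distrib)
    then show ?thesis using abs_le_square_iff[of a "2 * \<rho>"] assms(3) by simp
  qed
  have "i = 0 \<or> i = 1 \<or> i = 2" using assms(4) by linarith
  then show ?thesis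
    using assms *[of "d 0" "d 1" "d 2"] *[of "d 1" "d 2" "d 0"] *[of "d 2" "d 0" "d 1"]
    by (auto simp: sum_atMost_2 add_ac)
qed

text \<open>The factor by which the bound on \<open>Psi\<close> drops below its value \<open>3 powr (1 - \<gamma>)\<close> at the centre.\<close>

definition contraction :: "nat \<Rightarrow> real \<Rightarrow> real \<Rightarrow> real" where
  "contraction k \<gamma> x = (let \<beta> = \<gamma> * (real k - 1) / (real k * \<gamma> - 1) in
     ((1 + 2 * (x ^ k) powr \<beta>) / (1 + 2 * x ^ k) powr \<beta>) powr (real k * \<gamma> - 1))"

text \<open>Clearing the positive denominator leaves \<open>\<gamma> < 1\<close>.\<close>

lemma contraction_exponent:
  assumes "k \<ge> 3" "\<gamma> < 1" "real k * \<gamma> > 2"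
  shows "\<gamma> * (real k - 1) / (real k * \<gamma> - 1) > 1"
  using assms by (simp add: field_simps)

text \<open>The numbers \<open>1/T\<close>, \<open>X/T\<close>, \<open>X/T\<close> lie strictly
  between 0 and 1 and sum to 1, so raising each to a power above 1 makes the sum smaller.\<close>

lemma contraction_less_1:
  assumes k: "k \<ge> 3" "\<gamma> < 1" "real k * \<gamma> > 2" and x: "x > 0"
  shows "contraction k \<gamma> x < 1"
proof -
  define \<beta> where "\<beta> = \<gamma> * (real k - 1) / (real k * \<gamma> - 1)"
  have b: "\<beta> > 1" unfolding \<beta>_def using contraction_exponent[OF k] .
  define X T where "X = x ^ k" and "T = 1 + 2 * X"
  have X: "X > 0" using x by (simp add: X_def)
  have sub: "u powr \<beta> < u" if "0 < u" "u < 1" for u :: real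
    using powr_less_mono'[of u 1 \<beta>] that b by simp
  have "(1 + 2 * X powr \<beta>) / T powr \<beta> = (1 / T) powr \<beta> + 2 * (X / T) powr \<beta>"
    using X by (simp add: T_def powr_divide add_divide_distrib)
  also have "\<dots> < 1 / T + 2 * (X / T)"
    using X by (intro add_strict_mono mult_strict_left_mono sub) (auto simp: T_def)
  also have "\<dots> = 1" using X by (simp add: T_def field_simps)
  finally have "((1 + 2 * X powr \<beta>) / T powr \<beta>) powr (real k * \<gamma> - 1) < 1 powr (real k * \<gamma> - 1)"
    using k X by (intro powr_less_mono2) (auto simp: T_def)
  then show ?thesis unfolding contraction_def Let_def \<beta>_def[symmetric] by (simp add: X_def T_def)
qed

lemma contraction_le_1:
  assumes "k \<ge> 3" "\<gamma> < 1" "real k * \<gamma> > 2" "x \<ge> 0"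
  shows "contraction k \<gamma> x \<le> 1"
proof (cases "x = 0")
  case True
  then show ?thesis using assms by (simp add: contraction_def Let_def power_0_left)
next
  case False
  then show ?thesis using contraction_less_1[OF assms(1-3), of x] assms(4) by simp
qed

text \<open>A continuous function below 1 attains its maximum on the compact interval from
  \<open>e\<close> to 1.\<close>

lemma contraction_bounded_away:
  assumes k: "k \<ge> 3" "\<gamma> < 1" "real k * \<gamma> > 2" and e: "e > 0"
  shows "\<exists>d>0. \<forall>x. e \<le> x \<and> x \<le> 1 \<longrightarrow> contraction k \<gamma> x \<le> 1 - d"
proof (cases "e \<le> 1")
  case True
  have pos: "1 + 2 * x ^ k > 0" "1 + 2 * (x ^ k) powr b > 0" if "x > 0" for x b :: real
    using that by (auto intro!: add_pos_nonneg)
  have cont: "continuous_on {e..1} (contraction k \<gamma>)"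
    unfolding contraction_def Let_def using e pos
    by (intro continuous_intros) (auto simp: less_imp_neq[THEN not_sym])
  obtain z where z: "z \<in> {e..1}" "\<And>x. x \<in> {e..1} \<Longrightarrow> contraction k \<gamma> x \<le> contraction k \<gamma> z"
    using continuous_attains_sup[OF compact_Icc _ cont] True by auto
  show ?thesis
    using z contraction_less_1[OF k, of z] e by (intro exI[of _ "1 - contraction k \<gamma> z"]) auto
qed (auto intro!: exI[of _ 1])

text \<open>The parameter \<open>x\<close> is returned with the witnesses because it governs both
  the bound on \<open>Psi\<close> and the distance of \<open>l\<close> from the centre.\<close>

lemma Psi_le_contraction:
  fixes k :: nat and \<gamma> s :: real and l :: "nat \<Rightarrow> real"
  assumes k: "k \<ge> 3" and \<gamma>: "\<gamma> < 1" and K: "real k * \<gamma> > 2"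
    and s: "s > 0" and Qs: "Q s = real k * \<gamma>"
    and l: "\<forall>i\<le>2. l i > 0" "(\<Sum>i\<le>2. l i) = 1"
  obtains a c x where "\<And>i. i \<le> 2 \<Longrightarrow> a i > 0 \<and> c i > 0" "0 \<le> x" "x \<le> 1"
    "\<And>i. i \<le> 2 \<Longrightarrow> \<bar>l i - 1/3\<bar> \<le> 4 * x"
    "\<And>\<omega>. (\<forall>i\<le>2. \<omega> i \<ge> 0) \<Longrightarrow> (\<Sum>i\<le>2. \<omega> i) = 1 \<Longrightarrow>
       Psi k \<gamma> s \<omega> l a c \<le> 3 powr (1 - \<gamma>) * contraction k \<gamma> x"
proof -
  have \<gamma>0: "\<gamma> > 0" using K by (metis less_trans mult_nonneg_nonpos not_le of_nat_0_le_iff zero_less_numeral)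
  define n where "n = real k * \<gamma> - 1"
  define \<beta> where "\<beta> = \<gamma> * (real k - 1) / (real k * \<gamma> - 1)"
  have n: "n > 1" using K by (simp add: n_def)
  obtain c0 c1 c2 x :: real where c012: "c0 > 0" "c1 > 0" "c2 > 0" "c0 + c1 + c2 = 1"
    and x: "0 \<le> x" "x \<le> 1" "2 * x^2 = 3 * (c0^2 + c1^2 + c2^2) - 1"
    and st: "l 0 * (1 + 2 * x^k) = c0 * (1 + x^(k-2) * (3*c0 - 1))"
    "l 1 * (1 + 2 * x^k) = c1 * (1 + x^(k-2) * (3*c1 - 1))"
    "l 2 * (1 + 2 * x^k) = c2 * (1 + x^(k-2) * (3*c2 - 1))"
    using stationary_weights_exist[OF k, of "l 0" "l 1" "l 2"] l
    unfolding all_atMost_2 sum_atMost_2 by blast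
  define c where "c = (\<lambda>i::nat. if i = 0 then c0 else if i = 1 then c1 else c2)"
  define w where "w = (\<lambda>i. 1 + x^(k-2) * (3 * c i - 1))"
  define R where "R = 1 + 2 * x^k"
  define \<rho> where "\<rho> = x^(k-1)"
  \<comment> \<open>This scale sends the extremal triple
    \<open>(1 + 2\<rho>, 1 - \<rho>, 1 - \<rho>)\<close> to
    \<open>(s, s * y, s * y)\<close>.\<close>
  define t where "t = s / (1 + 2*\<rho>)"
  define a where "a = (\<lambda>i. t * w i)"
  define y where "y = (1 - \<rho>) / (1 + 2*\<rho>)"
  have c: "c i > 0" for i using c012 by (simp add: c_def)
  have c1: "c 0 + c 1 + c 2 = 1" and c2: "2 * x^2 = 3 * ((c 0)^2 + (c 1)^2 + (c 2)^2) - 1"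
    using c012 x by (simp_all add: c_def)
  have st: "l i * R = c i * w i" if "i \<le> 2" for i
  proof -
    have "i = 0 \<or> i = 1 \<or> i = 2" using that by linarith
    then show ?thesis using st by (auto simp: c_def w_def R_def)
  qed
  have R: "R \<ge> 1" using x by (simp add: R_def)
  have \<rho>: "0 \<le> \<rho>" "\<rho> \<le> 1" using x by (auto simp: \<rho>_def power_le_one)
  have t: "t > 0" using s \<rho> by (simp add: t_def)
  have ts: "t * (1 + 2*\<rho>) = s" using \<rho> by (simp add: t_def)
  have w: "w i > 0" if "i \<le> 2" for i
  proof -
    have "c i * w i > 0" using st[OF that] l(1) that R by (metis less_le_trans mult_pos_pos zero_less_one)
    then show ?thesis using c[of i] by (simp add: zero_less_mult_iff)
  qed
  have cen: "(\<Sum>i\<le>2. 3 * c i - 1) = 0" "(\<Sum>i\<le>2. (3 * c i - 1)^2) = 6 * x^2"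
    using c1 c2 unfolding sum_atMost_2 by (simp_all add: power2_eq_square algebra_simps) 
  have wsum: "(\<Sum>i\<le>2. w i - 1) = 0" "(\<Sum>i\<le>2. (w i - 1)^2) = 6 * \<rho>^2"
  proof -
    show "(\<Sum>i\<le>2. w i - 1) = 0"
      using cen(1) by (simp add: w_def sum_distrib_left[symmetric])
    have "(\<Sum>i\<le>2. (w i - 1)^2) = (x^(k-2))^2 * (6 * x^2)"
      using cen(2) by (simp add: w_def power_mult_distrib sum_distrib_left[symmetric])
    also have "\<dots> = 6 * (x^(k-2) * x)^2" by (simp add: power_mult_distrib)
    also have "x^(k-2) * x = \<rho>" unfolding \<rho>_def using k
      by (simp add: power_Suc2[symmetric] Suc_diff_le numeral_2_eq_2 Suc_diff_Suc)
    finally show "(\<Sum>i\<le>2. (w i - 1)^2) = 6 * \<rho>^2" .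
  qed
  have w_le: "w i \<le> 1 + 2*\<rho>" if "i \<le> 2" for i
    using abs_le_of_centered[OF wsum \<rho>(1) that] by linarith
  have dist: "\<bar>l i - 1/3\<bar> \<le> 4 * x" if i: "i \<le> 2" for i
  proof -
    have c3: "\<bar>3 * c i - 1\<bar> \<le> 2 * x" using abs_le_of_centered[OF cen x(1) i] .
    have "\<bar>w i - 1\<bar> = x^(k-2) * \<bar>3 * c i - 1\<bar>" using x by (simp add: w_def abs_mult)
    also have "\<dots> \<le> 1 * (2 * x)" using x c3 by (intro mult_mono) (auto intro: power_le_one)
    finally have w1: "\<bar>w i - 1\<bar> \<le> 2 * x" by simp
    have "\<bar>(3 * c i - 1) * w i\<bar> \<le> 2 * x * 3"
      using c3 w[OF i] w_le[OF i] \<rho> x unfolding abs_mult by (intro mult_mono) auto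
    moreover have "x^k \<le> x" using x k power_decreasing[of 1 k x] by simp
    moreover have "x^k \<ge> 0" using x by simp
    \<comment> \<open>The three terms on the right are at most \<open>6x\<close>, \<open>2x\<close>
      and \<open>2x\<close> in modulus; dividing their total by 3 stays below
      \<open>4x\<close>.\<close>
    moreover have "3 * R * (l i - 1/3) = (3 * c i - 1) * w i + (w i - 1) - 2 * x^k"
      using st[OF i] by (simp add: R_def algebra_simps)
    ultimately have "\<bar>3 * R * (l i - 1/3)\<bar> \<le> 10 * x" using w1 by linarith
    moreover have "\<bar>l i - 1/3\<bar> \<le> R * \<bar>l i - 1/3\<bar>" using R by (simp add: mult_le_cancel_right1)
    ultimately show ?thesis using R x by (simp add: abs_mult)
  qed
  have qs: "q s > 0" using s by (intro q_pos) simp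
  have "(\<Sum>i\<le>2. q (a i)) \<le> q s + 2 * q (s * y)"
  proof (rule sum_q_le_extremal)
    have sy: "s * y = t * (1 - \<rho>)" by (simp add: y_def t_def)
    show "a i \<le> s" if "i \<le> 2" for i
      using mult_left_mono[OF w_le[OF that], of t] t ts by (simp add: a_def)
    show "s * y \<le> s" 
      using mult_left_mono[of "1 - \<rho>" "1 + 2*\<rho>" t] t ts \<rho> unfolding sy by simp
    have d: "a i - s * y = t * ((w i - 1) + \<rho>)" for i unfolding a_def sy by (simp add: algebra_simps)
    have S: "s - s * y = t * (3 * \<rho>)" unfolding sy using ts by (simp add: algebra_simps)
    show "(\<Sum>i\<le>2. a i - s * y) = s - s * y"
      unfolding d S sum_distrib_left[symmetric] sum.distrib wsum by simp
    have "(\<Sum>i\<le>2. (a i - s * y)^2) = t^2 * (\<Sum>i\<le>2. (w i - 1)^2 + 2 * \<rho> * (w i - 1) + \<rho>^2)"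
      unfolding d power_mult_distrib sum_distrib_left by (intro sum.cong) (auto simp: power2_eq_square algebra_simps)
    also have "\<dots> = (s - s * y)^2"
      unfolding S sum.distrib sum_distrib_left[symmetric] wsum by (simp add: power_mult_distrib)
    finally show "(\<Sum>i\<le>2. (a i - s * y)^2) = (s - s * y)^2" .
  qed
  also have "\<dots> \<le> q s + 2 * (q s * (y^2 / (1 + (Q s - 2) * (1 - y))))"
    using q_scaled_upper_bound[OF s, of y] \<rho> K unfolding Qs by (simp add: y_def)
  also have "\<dots> = q s * (3 * (1 + (n - 1)*\<rho> + 2*n*\<rho>^2) / ((1 + 2*\<rho>) * (1 + (3*n - 1)*\<rho>)))"
  proof -
    have pos: "1 + 2*\<rho> > 0" "1 + (3*n - 1)*\<rho> > 0" using \<rho> n by (auto intro!: add_pos_nonneg)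
    have y1: "1 - y = 3*\<rho> / (1 + 2*\<rho>)" using pos by (simp add: y_def field_simps)
    have "1 + (Q s - 2) * (1 - y) = (1 + (3*n - 1)*\<rho>) / (1 + 2*\<rho>)"
      unfolding y1 using pos by (simp add: Qs n_def field_simps)
    then have f1: "y^2 / (1 + (Q s - 2) * (1 - y)) = (1 - \<rho>)^2 / ((1 + 2*\<rho>) * (1 + (3*n - 1)*\<rho>))"
      using pos by (simp add: y_def power_divide power2_eq_square)
    have f2: "1 + 2 * ((1 - \<rho>)^2 / ((1 + 2*\<rho>) * (1 + (3*n - 1)*\<rho>)))
        = 3 * (1 + (n - 1)*\<rho> + 2*n*\<rho>^2) / ((1 + 2*\<rho>) * (1 + (3*n - 1)*\<rho>))"
      using pos by (simp add: divide_simps) (simp add: power2_eq_square algebra_simps)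
    show ?thesis unfolding f1 f2[symmetric] by (simp add: distrib_left)
  qed
  finally have sumq: "(\<Sum>i\<le>2. q (a i) / q s)
      \<le> 3 * (1 + (n - 1)*\<rho> + 2*n*\<rho>^2) / ((1 + 2*\<rho>) * (1 + (3*n - 1)*\<rho>))" (is "_ \<le> ?F")
    using qs by (simp add: sum_divide_distrib[symmetric] divide_le_eq mult.commute)
  \<comment> \<open>The exponent is \<open>n + 1\<close>: one factor \<open>1 + 2*\<rho>\<close>
    cancels against the denominator, and what is left is the power mean inequality.\<close>
  have F: "?F * (1 + 2*\<rho>) powr (real k * \<gamma>) \<le> 3 * (1 + 2 * (x^k) powr \<beta>) powr n"
  proof -
    have pos: "1 + 2*\<rho> > 0" "1 + (3*n - 1)*\<rho> > 0" using \<rho> n by (auto intro!: add_pos_nonneg)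
    have "(1 + 2*\<rho>) powr (real k * \<gamma>) = (1 + 2*\<rho>) powr n * (1 + 2*\<rho>)"
      using pos by (simp add: n_def powr_diff)
    moreover have "3 * C / (A * B) * (p * A) = 3 * (p * C) / B" if "A > 0" for A B C p :: real
      using that by simp
    ultimately have "?F * (1 + 2*\<rho>) powr (real k * \<gamma>)
      = 3 * ((1 + 2*\<rho>) powr n * (1 + (n - 1)*\<rho> + 2*n*\<rho>^2)) / (1 + (3*n - 1)*\<rho>)"
      using pos(1) by simp
    also have "\<dots> \<le> 3 * (1 + 2 * (\<rho> * \<rho> powr (1/n))) powr n"
      using power_mean_lower_bound[OF n \<rho>] pos by (simp add: divide_le_eq mult_ac)
    also have "\<rho> * \<rho> powr (1/n) = (x^k) powr \<beta>"
    proof (cases "x = 0")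
      case True
      then show ?thesis using k by (simp add: \<rho>_def power_0_left)
    next
      case False
      then have x0: "x > 0" using x by simp
      have "\<rho> * \<rho> powr (1/n) = \<rho> powr (1 + 1/n)" using x0 by (simp add: \<rho>_def powr_add)
      also have "\<dots> = x powr (real (k-1) * (1 + 1/n))"
        using x0 by (simp add: \<rho>_def powr_powr flip: powr_realpow)
      \<comment> \<open>Here \<beta> equals \<open>\<gamma> * (k - 1) / n\<close>, while
        \<open>1 + 1/n\<close> equals \<open>k * \<gamma> / n\<close>.\<close>
      also have "real (k-1) * (1 + 1/n) = real k * \<beta>"
        using k n by (simp add: \<beta>_def n_def[symmetric]) (simp add: n_def field_simps)
      also have "x powr (real k * \<beta>) = (x^k) powr \<beta>"
        using x0 by (simp add: powr_powr flip: powr_realpow)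
      finally show ?thesis .
    qed
    finally show ?thesis .
  qed
  have r_le: "r k c \<le> R / 3"
  proof -
    have "(c 0)^2 + (c 1)^2 + (c 2)^2 - c 0 * c 1 - c 0 * c 2 - c 1 * c 2
      = (3 * ((c 0)^2 + (c 1)^2 + (c 2)^2) - (c 0 + c 1 + c 2)^2) / 2"
      by (simp add: power2_eq_square algebra_simps)
    also have "\<dots> = x^2" unfolding c1 using c2 by simp
    finally show ?thesis using r_le_Fourier[of c k] c x unfolding c1 by (simp add: less_imp_le R_def)
  qed
  have r0: "r k c \<ge> 0" unfolding r_def using c by (intro sum_nonneg) (auto simp: less_imp_le)
  have prod2: "(\<Prod>i\<le>2. cpow (l i * s / (a i * c i)) (l i)) = (1 + 2*\<rho>) / R"
  proof -
    \<comment> \<open>By stationarity \<open>a i * c i = t * l i * R\<close>, so the base of every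
      factor is the same and the exponents \<open>l i\<close> simply add up to 1.\<close>
    have "cpow (l i * s / (a i * c i)) (l i) = ((1 + 2*\<rho>) / R) powr l i" if i: "i \<le> 2" for i
    proof -
      have li: "l i > 0" using l i by simp
      have "a i * c i = t * (l i * R)" unfolding st[OF i] by (simp add: a_def)
      then have "l i * s / (a i * c i) = (1 + 2*\<rho>) / R"
        using ts t li R by (simp add: field_simps)
      then show ?thesis using li by (simp add: cpow_def)
    qed
    then have "(\<Prod>i\<le>2. cpow (l i * s / (a i * c i)) (l i)) = (\<Prod>i\<le>2. ((1 + 2*\<rho>) / R) powr l i)"
      by (intro prod.cong) auto
    also have "\<dots> = ((1 + 2*\<rho>) / R) powr (\<Sum>i\<le>2. l i)"
      using R \<rho> by (intro powr_sum[symmetric]) auto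
    finally show ?thesis using l R \<rho> by simp
  qed
  show thesis
  proof (rule that[OF _ x(1) x(2) dist])
    show "a i > 0 \<and> c i > 0" if "i \<le> 2" for i using c t w[OF that] by (simp add: a_def)
    fix \<omega> :: "nat \<Rightarrow> real" assume \<omega>: "\<forall>i\<le>2. \<omega> i \<ge> 0" "(\<Sum>i\<le>2. \<omega> i) = 1"
    have "(\<Prod>i\<le>2. cpow (q (a i) / (\<omega> i * q s)) (\<omega> i)) = (\<Prod>i\<le>2. cpow (q (a i) / q s / \<omega> i) (\<omega> i))"
      by (simp add: mult.commute)
    also have "\<dots> \<le> (\<Sum>i\<le>2. q (a i) / q s)"
      using \<omega> qs t w by (intro Gibbs_cpow) (auto intro!: divide_pos_pos q_pos simp: a_def less_imp_neq[THEN not_sym])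
    also note sumq
    finally have prod1: "(\<Prod>i\<le>2. cpow (q (a i) / (\<omega> i * q s)) (\<omega> i)) \<le> ?F" .
    have F0: "?F \<ge> 0"
      using \<rho> n by (intro divide_nonneg_nonneg mult_nonneg_nonneg add_nonneg_nonneg) auto
    have "Psi k \<gamma> s \<omega> l a c \<le> ?F * ((1 + 2*\<rho>) / R) powr (real k * \<gamma>) * (R / 3) powr \<gamma>"
      unfolding Psi_def prod2
      by (intro mult_mono[OF mult_right_mono[OF prod1]] powr_mono2 mult_nonneg_nonneg
          powr_ge_zero r_le r0 F0 less_imp_le[OF \<gamma>0])
    also have "\<dots> = (?F * (1 + 2*\<rho>) powr (real k * \<gamma>)) * (R powr \<gamma> / 3 powr \<gamma> / R powr (real k * \<gamma>))"
      using R \<rho> by (simp add: powr_divide)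
    also have "\<dots> \<le> (3 * (1 + 2 * (x^k) powr \<beta>) powr n) * (R powr \<gamma> / 3 powr \<gamma> / R powr (real k * \<gamma>))"
      by (intro mult_right_mono F) auto
    also have "\<dots> = 3 powr (1 - \<gamma>) * contraction k \<gamma> x"
    proof -
      have "(R powr \<beta>) powr n = R powr (real k * \<gamma> - \<gamma>)"
        using n by (simp add: powr_powr \<beta>_def n_def[symmetric]) (simp add: n_def algebra_simps)
      then have "contraction k \<gamma> x = (1 + 2 * (x^k) powr \<beta>) powr n * (R powr \<gamma> / R powr (real k * \<gamma>))"
        unfolding contraction_def Let_def \<beta>_def[symmetric] unfolding n_def[symmetric] R_def[symmetric]
        using R by (simp add: powr_divide powr_diff)
      then show ?thesis by (simp add: powr_diff)
    qed
    finally show "Psi k \<gamma> s \<omega> l a c \<le> 3 powr (1 - \<gamma>) * contraction k \<gamma> x" .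
  qed
qed

text \<open>Quantifying \<delta> as a function of \<epsilon> ahead of \<open>l\<close> makes the gap
  uniform in \<open>l\<close> and \<open>\<omega>\<close>.\<close>

theorem theorem5:
  fixes k :: nat and \<gamma> s :: real
  assumes "k \<ge> 3" and "\<gamma> < 1" and "real k * \<gamma> > 2"
    and "s > 0" and "Q s = real k * \<gamma>"
  shows "\<exists>\<delta> :: real \<Rightarrow> real. (\<forall>\<epsilon>>0. \<delta> \<epsilon> > 0) \<and>
    (\<forall>l :: nat \<Rightarrow> real. (\<forall>i\<le>2. l i > 0) \<and> (\<Sum>i\<le>2. l i) = 1 \<longrightarrow>
      (\<exists>a c :: nat \<Rightarrow> real. (\<forall>i\<le>2. a i > 0 \<and> c i > 0) \<and>
        (\<forall>\<omega> :: nat \<Rightarrow> real. (\<forall>i\<le>2. \<omega> i \<ge> 0) \<and> (\<Sum>i\<le>2. \<omega> i) = 1 \<longrightarrow>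
          Psi k \<gamma> s \<omega> l a c \<le> 3 powr (1 - \<gamma>) \<and>
          (\<forall>\<epsilon>>0. (l 1, l 2) \<notin> U \<epsilon> (1/3) (1/3) \<longrightarrow>
             Psi k \<gamma> s \<omega> l a c \<le> 3 powr (1 - \<gamma>) - \<delta> \<epsilon>))))"
proof -
  \<comment> \<open>Outside the \<epsilon>-neighbourhood some \<open>l i\<close> is at least
    \<epsilon> away from 1/3, and that distance is at most \<open>4 * x\<close>; hence
    \<open>x \<ge> \<epsilon> / 4\<close>.\<close>
  have "\<forall>\<epsilon>>0. \<exists>d>0. \<forall>x. \<epsilon> / 4 \<le> x \<and> x \<le> 1 \<longrightarrow> contraction k \<gamma> x \<le> 1 - d"
    using contraction_bounded_away[OF assms(1-3), of "_ / 4"] by (intro allI impI) simp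
  then obtain d where d: "\<And>\<epsilon>. \<epsilon> > 0 \<Longrightarrow> d \<epsilon> > 0"
      "\<And>\<epsilon> x. \<epsilon> > 0 \<Longrightarrow> \<epsilon> / 4 \<le> x \<Longrightarrow> x \<le> 1 \<Longrightarrow> contraction k \<gamma> x \<le> 1 - d \<epsilon>"
    by metis
  show ?thesis
  proof (intro exI[of _ "\<lambda>\<epsilon>. 3 powr (1 - \<gamma>) * d \<epsilon>"] conjI allI impI)
    show "3 powr (1 - \<gamma>) * d \<epsilon> > 0" if "\<epsilon> > 0" for \<epsilon> using d(1)[OF that] by simp
    fix l :: "nat \<Rightarrow> real" assume l: "(\<forall>i\<le>2. l i > 0) \<and> (\<Sum>i\<le>2. l i) = 1"
    obtain a c x where ac: "\<And>i. i \<le> 2 \<Longrightarrow> a i > 0 \<and> c i > 0" and x: "0 \<le> x" "x \<le> 1"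
      and dist: "\<And>i. i \<le> 2 \<Longrightarrow> \<bar>l i - 1/3\<bar> \<le> 4 * x"
      and Psi: "\<And>\<omega>. (\<forall>i\<le>2. \<omega> i \<ge> 0) \<Longrightarrow> (\<Sum>i\<le>2. \<omega> i) = 1 \<Longrightarrow>
         Psi k \<gamma> s \<omega> l a c \<le> 3 powr (1 - \<gamma>) * contraction k \<gamma> x"
      by (rule Psi_le_contraction[OF assms conjunct1[OF l] conjunct2[OF l]]) (rule that)
    show "\<exists>a c :: nat \<Rightarrow> real. (\<forall>i\<le>2. a i > 0 \<and> c i > 0) \<and>
        (\<forall>\<omega> :: nat \<Rightarrow> real. (\<forall>i\<le>2. \<omega> i \<ge> 0) \<and> (\<Sum>i\<le>2. \<omega> i) = 1 \<longrightarrow>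
          Psi k \<gamma> s \<omega> l a c \<le> 3 powr (1 - \<gamma>) \<and>
          (\<forall>\<epsilon>>0. (l 1, l 2) \<notin> U \<epsilon> (1/3) (1/3) \<longrightarrow>
             Psi k \<gamma> s \<omega> l a c \<le> 3 powr (1 - \<gamma>) - 3 powr (1 - \<gamma>) * d \<epsilon>))"
    proof (rule exI[of _ a], rule exI[of _ c], intro conjI allI impI)
      show "a i > 0" "c i > 0" if "i \<le> 2" for i using ac[OF that] by auto
      fix \<omega> :: "nat \<Rightarrow> real" assume \<omega>: "(\<forall>i\<le>2. \<omega> i \<ge> 0) \<and> (\<Sum>i\<le>2. \<omega> i) = 1"
      note Psi\<omega> = Psi[OF conjunct1[OF \<omega>] conjunct2[OF \<omega>]]
      have "3 powr (1 - \<gamma>) * contraction k \<gamma> x \<le> 3 powr (1 - \<gamma>) * 1"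
        by (intro mult_left_mono contraction_le_1 assms x) simp
      then show "Psi k \<gamma> s \<omega> l a c \<le> 3 powr (1 - \<gamma>)" using Psi\<omega> by linarith
      fix \<epsilon> :: real assume e: "\<epsilon> > 0" "(l 1, l 2) \<notin> U \<epsilon> (1/3) (1/3)"
      then have "\<epsilon> / 4 \<le> x" using dist[of 1] dist[of 2] by (auto simp: U_def)
      then have "3 powr (1 - \<gamma>) * contraction k \<gamma> x \<le> 3 powr (1 - \<gamma>) * (1 - d \<epsilon>)"
        using d(2) e x by (intro mult_left_mono) auto
      then show "Psi k \<gamma> s \<omega> l a c \<le> 3 powr (1 - \<gamma>) - 3 powr (1 - \<gamma>) * d \<epsilon>"
        using Psi\<omega> by (simp add: right_diff_distrib)
    qed
  qed
qed

end
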